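(* Let $R$ be an associative ring with non-zero identity element, let $n\ge 2$, and let $T$ be an (abstract) principal multiplier matrix of order $n$ over $R$. Then there exists a $(01)$-formal matrix ring $M(n,R,\Sigma)$ over $R$ whose principal multiplier matrix coincides with $T$.
   Context: Formal matrix rings over $R$. Let $\Sigma=\{s_{ijk}\mid i,j,k=1,\ldots,n\}$ be a set of central elements of $R$ such that $s_{iik}=1=s_{ikk}$ and $s_{ijk}s_{ik\ell}=s_{ij\ell}s_{jk\ell}$ for all $i,j,k,\ell\in\{1,\ldots,n\}$. The ring $M(n,R,\Sigma)$ is the set of all $n\times n$ matrices over $R$ with entrywise addition and with multiplication $(a_{ij})(b_{ij})=(c_{ij})$, where $c_{ij}=\sum_{k=1}^n s_{ikj}a_{ik}b_{kj}$. It is called a formal matrix ring over $R$; $\Sigma$ is its multiplier system and the $s_{ijk}$ are its multipliers. The principal multiplier matrix of $M(n,R,\Sigma)$ is the $n\times n$ matrix $S=(s_{iji})$, whose $(i,j)$ entry is $s_{iji}$. A $(01)$-formal matrix ring is a ring $M(n,R,\Sigma)$ in which every multiplier $s_{ijk}$ equals $0$ or $1$. Abstract principal multiplier matrices. A symmetric $n\times n$ matrix $T=(t_{ij})$ with all entries in $\{0,1\}\subset R$ is called an (abstract) principal multiplier matrix if all its main diagonal entries equal $1$ and, for any pairwise distinct $i,j,k$, one of the following holds for the three elements $t_{ij},t_{jk},t_{ki}$: (1) all three equal $1$; (2) some two of them equal $0$ and the third equals $1$; (3) all three equal $0$. *)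

theory Defs
  imports "Jordan_Normal_Form.Matrix"
begin

(* The indices 1..n are shifted to 0..n-1, the index range of carrier_mat n n.
   A multiplier s_ijk is written s i j k; the values of s at indices outside
   the range are irrelevant. *)

definition multiplier_system :: "nat \<Rightarrow> (nat \<Rightarrow> nat \<Rightarrow> nat \<Rightarrow> 'a::ring_1) \<Rightarrow> bool" where
  "multiplier_system n s \<longleftrightarrow>
     (\<forall>i<n. \<forall>j<n. \<forall>k<n. \<forall>r. s i j k * r = r * s i j k) \<and>
     (\<forall>i<n. \<forall>k<n. s i i k = 1 \<and> s i k k = 1) \<and>
     (\<forall>i<n. \<forall>j<n. \<forall>k<n. \<forall>l<n. s i j k * s i k l = s i j l * s j k l)"

definition formal_matrix_mult ::
    "nat \<Rightarrow> (nat \<Rightarrow> nat \<Rightarrow> nat \<Rightarrow> 'a::ring_1) \<Rightarrow> 'a mat \<Rightarrow> 'a mat \<Rightarrow> 'a mat" where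
  "formal_matrix_mult n s A B =
     mat n n (\<lambda>(i, j). \<Sum>k<n. s i k j * A $$ (i, k) * B $$ (k, j))"

definition formal_matrix_ring ::
    "nat \<Rightarrow> (nat \<Rightarrow> nat \<Rightarrow> nat \<Rightarrow> 'a::ring_1) \<Rightarrow> 'a mat ring" where
  "formal_matrix_ring n s =
     \<lparr>carrier = carrier_mat n n,
      mult = formal_matrix_mult n s,
      one = 1\<^sub>m n,
      zero = 0\<^sub>m n n,
      add = (+)\<rparr>"

definition zero_one_multipliers :: "nat \<Rightarrow> (nat \<Rightarrow> nat \<Rightarrow> nat \<Rightarrow> 'a::ring_1) \<Rightarrow> bool" where
  "zero_one_multipliers n s \<longleftrightarrow> (\<forall>i<n. \<forall>j<n. \<forall>k<n. s i j k = 0 \<or> s i j k = 1)"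

definition principal_multiplier_matrix ::
    "nat \<Rightarrow> (nat \<Rightarrow> nat \<Rightarrow> nat \<Rightarrow> 'a::ring_1) \<Rightarrow> 'a mat" where
  "principal_multiplier_matrix n s = mat n n (\<lambda>(i, j). s i j i)"

definition abstract_principal_multiplier_matrix :: "nat \<Rightarrow> 'a::ring_1 mat \<Rightarrow> bool" where
  "abstract_principal_multiplier_matrix n T \<longleftrightarrow>
     T \<in> carrier_mat n n \<and>
     transpose_mat T = T \<and>
     (\<forall>i<n. \<forall>j<n. T $$ (i, j) \<in> {0, 1}) \<and>
     (\<forall>i<n. T $$ (i, i) = 1) \<and>
     (\<forall>i<n. \<forall>j<n. \<forall>k<n. i \<noteq> j \<and> j \<noteq> k \<and> i \<noteq> k \<longrightarrow>
        (T $$ (i, j) = 1 \<and> T $$ (j, k) = 1 \<and> T $$ (k, i) = 1) \<or>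
        (T $$ (i, j) = 0 \<and> T $$ (j, k) = 0 \<and> T $$ (k, i) = 1) \<or>
        (T $$ (i, j) = 0 \<and> T $$ (j, k) = 1 \<and> T $$ (k, i) = 0) \<or>
        (T $$ (i, j) = 1 \<and> T $$ (j, k) = 0 \<and> T $$ (k, i) = 0) \<or>
        (T $$ (i, j) = 0 \<and> T $$ (j, k) = 0 \<and> T $$ (k, i) = 0))"

lemma ring_formal_matrix_ring:
  fixes s :: "nat \<Rightarrow> nat \<Rightarrow> nat \<Rightarrow> 'a::ring_1"
  assumes "multiplier_system n s"
  shows "ring (formal_matrix_ring n s)"
proof -
  note system = assms[unfolded multiplier_system_def]
  have central: "s i j k * r = r * s i j k" if "i < n" "j < n" "k < n" for i j k r
    using system[THEN conjunct1] that by blast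
  have unit: "s i i k = 1" "s i k k = 1" if "i < n" "k < n" for i k
    using system[THEN conjunct2, THEN conjunct1] that by blast+
  have cocycle: "s i j k * s i k l = s i j l * s j k l"
    if "i < n" "j < n" "k < n" "l < n" for i j k l
    using system[THEN conjunct2, THEN conjunct2] that by blast
  have assoc: "formal_matrix_mult n s (formal_matrix_mult n s A B) C =
      formal_matrix_mult n s A (formal_matrix_mult n s B C)" (is "?L = ?R") for A B C
  proof (rule eq_matI)
    fix i j assume "i < dim_row ?R" "j < dim_col ?R"
    then have ij: "i < n" "j < n" by (auto simp: formal_matrix_mult_def)
    have term_eq: "s i k j * (s i m k * A $$ (i, m) * B $$ (m, k)) * C $$ (k, j) =
        s i m j * A $$ (i, m) * (s m k j * B $$ (m, k) * C $$ (k, j))"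
      if "k < n" "m < n" for k m
    proof -
      have "s i k j * (s i m k * A $$ (i, m) * B $$ (m, k)) * C $$ (k, j) =
          (s i k j * s i m k) * (A $$ (i, m) * B $$ (m, k) * C $$ (k, j))"
        by (simp add: mult.assoc)
      also have "s i k j * s i m k = s i m j * s m k j"
        using ij that by (intro trans[OF central cocycle])
      also have "s i m j * s m k j * (A $$ (i, m) * B $$ (m, k) * C $$ (k, j)) =
          s i m j * (s m k j * A $$ (i, m)) * (B $$ (m, k) * C $$ (k, j))"
        by (simp add: mult.assoc)
      also have "s m k j * A $$ (i, m) = A $$ (i, m) * s m k j"
        using central ij that by blast
      finally show ?thesis by (simp add: mult.assoc)
    qed
    have "?L $$ (i, j) =
        (\<Sum>k<n. \<Sum>m<n. s i k j * (s i m k * A $$ (i, m) * B $$ (m, k)) * C $$ (k, j))"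
      using ij by (simp add: formal_matrix_mult_def sum_distrib_left sum_distrib_right)
    also have "\<dots> = (\<Sum>k<n. \<Sum>m<n. s i m j * A $$ (i, m) * (s m k j * B $$ (m, k) * C $$ (k, j)))"
      by (intro sum.cong refl term_eq) auto
    also have "\<dots> = (\<Sum>m<n. \<Sum>k<n. s i m j * A $$ (i, m) * (s m k j * B $$ (m, k) * C $$ (k, j)))"
      by (rule sum.swap)
    also have "\<dots> = ?R $$ (i, j)"
      using ij by (simp add: formal_matrix_mult_def sum_distrib_left)
    finally show "?L $$ (i, j) = ?R $$ (i, j)" .
  qed (simp_all add: formal_matrix_mult_def)
  have one_left: "formal_matrix_mult n s (1\<^sub>m n) A = A" if A: "A \<in> carrier_mat n n" for A
  proof (rule eq_matI)
    fix i j assume "i < dim_row A" "j < dim_col A"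
    with A have ij: "i < n" "j < n" by auto
    have "formal_matrix_mult n s (1\<^sub>m n) A $$ (i, j) =
        (\<Sum>k<n. if k = i then s i i j * A $$ (i, j) else 0)"
      using ij by (auto simp: formal_matrix_mult_def simp del: sum.delta sum.delta' intro!: sum.cong)
    then show "formal_matrix_mult n s (1\<^sub>m n) A $$ (i, j) = A $$ (i, j)"
      using ij unit by (simp add: sum.delta)
  qed (use A in \<open>auto simp: formal_matrix_mult_def\<close>)
  have one_right: "formal_matrix_mult n s A (1\<^sub>m n) = A" if A: "A \<in> carrier_mat n n" for A
  proof (rule eq_matI)
    fix i j assume "i < dim_row A" "j < dim_col A"
    with A have ij: "i < n" "j < n" by auto
    have "formal_matrix_mult n s A (1\<^sub>m n) $$ (i, j) =
        (\<Sum>k<n. if k = j then s i j j * A $$ (i, j) else 0)"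
      using ij by (auto simp: formal_matrix_mult_def simp del: sum.delta sum.delta' intro!: sum.cong)
    then show "formal_matrix_mult n s A (1\<^sub>m n) $$ (i, j) = A $$ (i, j)"
      using ij unit by (simp add: sum.delta)
  qed (use A in \<open>auto simp: formal_matrix_mult_def\<close>)
  have r_distr: "formal_matrix_mult n s (A + B) C =
      formal_matrix_mult n s A C + formal_matrix_mult n s B C"
    if "A \<in> carrier_mat n n" "B \<in> carrier_mat n n" for A B C
    using that by (intro eq_matI)
      (auto simp: formal_matrix_mult_def distrib_left distrib_right sum.distrib)
  have l_distr: "formal_matrix_mult n s C (A + B) =
      formal_matrix_mult n s C A + formal_matrix_mult n s C B"
    if "A \<in> carrier_mat n n" "B \<in> carrier_mat n n" for A B C
    using that by (intro eq_matI)
      (auto simp: formal_matrix_mult_def distrib_left distrib_right sum.distrib)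
  have closed: "formal_matrix_mult n s A B \<in> carrier_mat n n" for A B
    by (simp add: formal_matrix_mult_def)
  show ?thesis
  proof (rule ringI)
    show "abelian_group (formal_matrix_ring n s)"
    proof (rule abelian_groupI)
      fix A assume "A \<in> carrier (formal_matrix_ring n s)"
      then show "\<exists>B\<in>carrier (formal_matrix_ring n s).
          B \<oplus>\<^bsub>formal_matrix_ring n s\<^esub> A = \<zero>\<^bsub>formal_matrix_ring n s\<^esub>"
        by (intro bexI[of _ "- A"]) (auto simp: formal_matrix_ring_def)
    qed (auto simp: formal_matrix_ring_def assoc_add_mat intro: comm_add_mat)
    show "monoid (formal_matrix_ring n s)"
      by (rule monoidI)
        (auto simp: formal_matrix_ring_def closed assoc one_left one_right)
  qed (simp_all add: formal_matrix_ring_def r_distr l_distr)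
qed

end

theory Submission
  imports Defs
begin

text \<open>
  The conditions on \<open>T\<close> say that \<open>i \<sim> j \<longleftrightarrow> t\<^sub>i\<^sub>j = 1\<close> is an equivalence relation: a triple of
  entries with exactly one \<open>0\<close> is what a failure of transitivity would look like. Hence
  \<open>d i j = 0\<close> for \<open>i \<sim> j\<close> and \<open>d i j = 1\<close> otherwise is a pseudometric on the indices.

  Any function \<open>d\<close> with zero diagonal that satisfies the triangle inequality yields a
  \<open>(01)\<close>-multiplier system: let \<open>s\<^sub>i\<^sub>j\<^sub>k\<close> be \<open>1\<close> if \<open>j\<close> lies on a shortest way from \<open>i\<close> to \<open>k\<close>, that is
  if \<open>d i j + d j k = d i k\<close>, and \<open>0\<close> otherwise. Both sides of the multiplier identity then test
  whether \<open>i, j, k, l\<close> lie in this order on a shortest way from \<open>i\<close> to \<open>l\<close>. For the pseudometric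
  above, \<open>s\<^sub>i\<^sub>j\<^sub>i = 1\<close> means \<open>2 * d i j = 0\<close>, that is \<open>t\<^sub>i\<^sub>j = 1\<close>.
\<close>

definition between_multiplier :: "(nat \<Rightarrow> nat \<Rightarrow> nat) \<Rightarrow> nat \<Rightarrow> nat \<Rightarrow> nat \<Rightarrow> 'a::ring_1" where
  "between_multiplier d i j k = of_bool (d i j + d j k = d i k)"

lemma zero_one_between_multiplier: "zero_one_multipliers n (between_multiplier d)"
  by (simp add: zero_one_multipliers_def between_multiplier_def)

text \<open>
  The length \<open>d i j + d j k + d k l\<close> exceeds \<open>d i l\<close> by a sum of two nonnegative defects in two ways,
  according to whether \<open>j\<close> or \<open>k\<close> is left out first. The two products of multipliers test the
  vanishing of both defects in the respective decomposition, so each is \<open>1\<close> exactly if the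
  total excess is zero.
\<close>
lemma multiplier_system_between_multiplier:
  assumes diag: "\<And>i. i < n \<Longrightarrow> d i i = 0"
    and triangle: "\<And>i j k. \<lbrakk>i < n; j < n; k < n\<rbrakk> \<Longrightarrow> d i k \<le> d i j + d j k"
  shows "multiplier_system n (between_multiplier d :: nat \<Rightarrow> nat \<Rightarrow> nat \<Rightarrow> 'a::ring_1)"
proof -
  have excess: "(d i j + d j k = d i k \<and> d i k + d k l = d i l) \<longleftrightarrow>
        (d i j + d j l = d i l \<and> d j k + d k l = d j l)"
    if "i < n" "j < n" "k < n" "l < n" for i j k l
    using triangle[of i j k] triangle[of i k l] triangle[of i j l] triangle[of j k l] that
    by linarith
  have "between_multiplier d i j k * between_multiplier d i k l =
        (between_multiplier d i j l * between_multiplier d j k l :: 'a)"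
    if "i < n" "j < n" "k < n" "l < n" for i j k l
    unfolding between_multiplier_def of_bool_conj[symmetric] excess[OF that] ..
  moreover have "between_multiplier d i j k * r = r * between_multiplier d i j k" for i j k and r :: 'a
    by (simp add: between_multiplier_def)
  moreover have "between_multiplier d i i k = (1 :: 'a)" "between_multiplier d i k k = (1 :: 'a)"
    if "i < n" "k < n" for i k
    using that by (simp_all add: between_multiplier_def diag)
  ultimately show ?thesis
    unfolding multiplier_system_def by blast
qed

lemma abstract_principal_multiplier_matrix_sym:
  assumes "abstract_principal_multiplier_matrix n T" and "i < n" "j < n"
  shows "T $$ (i, j) = T $$ (j, i)"
proof -
  have T: "T \<in> carrier_mat n n" "transpose_mat T = T"
    using assms(1) by (simp_all add: abstract_principal_multiplier_matrix_def)
  then have "transpose_mat T $$ (i, j) = T $$ (j, i)"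
    using assms(2,3) by (intro index_transpose_mat) auto
  then show ?thesis
    by (simp add: T)
qed

lemma abstract_principal_multiplier_matrix_trans:
  fixes T :: "'a::ring_1 mat"
  assumes T: "abstract_principal_multiplier_matrix n T"
    and ijk: "i < n" "j < n" "k < n"
    and one: "T $$ (i, j) = 1" "T $$ (j, k) = 1"
  shows "T $$ (i, k) = 1"
proof (cases "i = j \<or> j = k \<or> i = k")
  case True
  then show ?thesis
    using T ijk one by (auto simp: abstract_principal_multiplier_matrix_def)
next
  case False
  then have "T $$ (k, i) = 1"
    using T[unfolded abstract_principal_multiplier_matrix_def, THEN conjunct2, THEN conjunct2,
        THEN conjunct2, THEN conjunct2, rule_format, OF ijk] one
    by simp
  then show ?thesis
    using abstract_principal_multiplier_matrix_sym[OF T] ijk by simp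
qed

theorem theorem3p1:
  fixes T :: "'a::ring_1 mat" and n :: nat
  assumes "n \<ge> 2"
    and "abstract_principal_multiplier_matrix n T"
  shows "\<exists>s :: nat \<Rightarrow> nat \<Rightarrow> nat \<Rightarrow> 'a.
           multiplier_system n s \<and>
           ring (formal_matrix_ring n s) \<and>
           zero_one_multipliers n s \<and>
           principal_multiplier_matrix n s = T"
proof -
  have carrier: "T \<in> carrier_mat n n"
    and entries: "\<And>i j. \<lbrakk>i < n; j < n\<rbrakk> \<Longrightarrow> T $$ (i, j) = 0 \<or> T $$ (i, j) = 1"
    and diag: "\<And>i. i < n \<Longrightarrow> T $$ (i, i) = 1"
    using assms(2) by (auto simp: abstract_principal_multiplier_matrix_def)
  define d :: "nat \<Rightarrow> nat \<Rightarrow> nat" where "d i j = of_bool (T $$ (i, j) \<noteq> 1)" for i j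
  let ?s = "between_multiplier d :: nat \<Rightarrow> nat \<Rightarrow> nat \<Rightarrow> 'a"
  have system: "multiplier_system n ?s"
  proof (rule multiplier_system_between_multiplier)
    show "d i k \<le> d i j + d j k" if "i < n" "j < n" "k < n" for i j k
      using abstract_principal_multiplier_matrix_trans[OF assms(2) that]
      by (auto simp: d_def)
  qed (simp add: d_def diag)
  have "principal_multiplier_matrix n ?s = T"
  proof (rule eq_matI)
    fix i j assume "i < dim_row T" "j < dim_col T"
    with carrier have ij: "i < n" "j < n" by auto
    show "principal_multiplier_matrix n ?s $$ (i, j) = T $$ (i, j)"
      using ij entries[OF ij] abstract_principal_multiplier_matrix_sym[OF assms(2) ij] diag
      by (auto simp: principal_multiplier_matrix_def between_multiplier_def d_def)
  qed (use carrier in \<open>auto simp: principal_multiplier_matrix_def\<close>)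
  then show ?thesis
    using system ring_formal_matrix_ring[OF system] zero_one_between_multiplier by blast
qed

end
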